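(* Let $F(\tau)=\eta^6(\tau)\Big/\Big(\theta\begin{bmatrix}1/5\\1/5\end{bmatrix}(0,\tau)\,\theta\begin{bmatrix}1/5\\9/5\end{bmatrix}(0,\tau)\Big)$. For every $M=\begin{pmatrix} a&b\\ c&d\end{pmatrix}\in\Gamma_{\theta,5}$, $F(M\tau)=\nu_F(M)(c\tau+d)^2F(\tau)$ with $\nu_F(M)=\exp\!\left(\frac{\pi i}{5}f(M)\right)$, where $f(M)=\frac{4b}{5}+\frac{8ab}{5}+\frac{8cd}{5}$ if $M\equiv I\pmod5$; $f(M)=\frac{6b}{5}+\frac{8ab}{5}+\frac{8cd}{5}$ if $M\equiv -I\pmod5$; $f(M)=5+\frac{4d}{5}+\frac{8ab}{5}+\frac{8cd}{5}$ if $M\equiv\begin{pmatrix}0&-1\\1&0\end{pmatrix}\pmod5$; $f(M)=5-\frac{4d}{5}+\frac{8ab}{5}+\frac{8cd}{5}$ if $M\equiv\begin{pmatrix}0&1\\-1&0\end{pmatrix}\pmod5$.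
   Context: $\mathscr{H}$ is the upper half plane, $M\tau=\frac{a\tau+b}{c\tau+d}$, $I$ the identity matrix. $\theta\begin{bmatrix}\epsilon\\ \epsilon'\end{bmatrix}(v,\tau)=\sum_{n\in\mathbb{Z}}\exp\!\Big(2\pi i\Big[\tfrac12\big(n+\tfrac{\epsilon}{2}\big)^2\tau+\big(n+\tfrac{\epsilon}{2}\big)\big(v+\tfrac{\epsilon'}{2}\big)\Big]\Big)$. $\eta(\tau)=q^{1/24}\prod_{n\ge1}(1-q^n)$, $q=e^{2\pi i\tau}$. $\Gamma_{\theta,5}=\{M\in SL(2,\mathbb{Z}): M\equiv\pm\begin{pmatrix}1&0\\0&1\end{pmatrix}\text{ or }\pm\begin{pmatrix}0&-1\\1&0\end{pmatrix}\pmod 5\}$. *)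

theory Defs
  imports "HOL-Analysis.Analysis" "HOL-Number_Theory.Cong"
begin

definition theta_char :: "real \<Rightarrow> real \<Rightarrow> complex \<Rightarrow> complex \<Rightarrow> complex" where
  "theta_char eps eps' v \<tau> =
     (\<Sum>\<^sub>\<infinity>n::int. exp (2 * pi * \<i> *
        ((1/2) * (of_int n + of_real eps / 2)^2 * \<tau>
         + (of_int n + of_real eps / 2) * (v + of_real eps' / 2))))"

definition dedekind_eta :: "complex \<Rightarrow> complex" where
  "dedekind_eta \<tau> = exp (2 * pi * \<i> * \<tau> / 24) *
     (\<Prod>n. (1 - exp (2 * pi * \<i> * \<tau>) ^ Suc n))"

definition F_fun :: "complex \<Rightarrow> complex" where
  "F_fun \<tau> = dedekind_eta \<tau> ^ 6 /
     (theta_char (1/5) (1/5) 0 \<tau> * theta_char (1/5) (9/5) 0 \<tau>)"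

definition cong_I5 :: "int \<Rightarrow> int \<Rightarrow> int \<Rightarrow> int \<Rightarrow> bool" where
  "cong_I5 a b c d \<longleftrightarrow> [a = 1] (mod 5) \<and> [b = 0] (mod 5) \<and> [c = 0] (mod 5) \<and> [d = 1] (mod 5)"
definition cong_mI5 :: "int \<Rightarrow> int \<Rightarrow> int \<Rightarrow> int \<Rightarrow> bool" where
  "cong_mI5 a b c d \<longleftrightarrow> [a = -1] (mod 5) \<and> [b = 0] (mod 5) \<and> [c = 0] (mod 5) \<and> [d = -1] (mod 5)"
definition cong_S5 :: "int \<Rightarrow> int \<Rightarrow> int \<Rightarrow> int \<Rightarrow> bool" where
  "cong_S5 a b c d \<longleftrightarrow> [a = 0] (mod 5) \<and> [b = -1] (mod 5) \<and> [c = 1] (mod 5) \<and> [d = 0] (mod 5)"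
definition cong_mS5 :: "int \<Rightarrow> int \<Rightarrow> int \<Rightarrow> int \<Rightarrow> bool" where
  "cong_mS5 a b c d \<longleftrightarrow> [a = 0] (mod 5) \<and> [b = 1] (mod 5) \<and> [c = -1] (mod 5) \<and> [d = 0] (mod 5)"

definition Gamma_theta5 :: "(int \<times> int \<times> int \<times> int) set" where
  "Gamma_theta5 = {(a, b, c, d). a * d - b * c = 1 \<and>
     (cong_I5 a b c d \<or> cong_mI5 a b c d \<or> cong_S5 a b c d \<or> cong_mS5 a b c d)}"

definition f_M :: "int \<Rightarrow> int \<Rightarrow> int \<Rightarrow> int \<Rightarrow> real" where
  "f_M a b c d =
    (if cong_I5 a b c d then 4 * b / 5 + 8 * a * b / 5 + 8 * c * d / 5
     else if cong_mI5 a b c d then 6 * b / 5 + 8 * a * b / 5 + 8 * c * d / 5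
     else if cong_S5 a b c d then 5 + 4 * d / 5 + 8 * a * b / 5 + 8 * c * d / 5
     else 5 - 4 * d / 5 + 8 * a * b / 5 + 8 * c * d / 5)"

definition nu_F :: "int \<Rightarrow> int \<Rightarrow> int \<Rightarrow> int \<Rightarrow> complex" where
  "nu_F a b c d = exp (pi * \<i> / 5 * of_real (f_M a b c d))"

end

(* Up to a constant, theta_char eps eps' 0 tau / eta(tau)^3 is the Klein form k_(r,s)(tau) with
   (r,s) = ((1+eps)/2, (1+eps')/2); this rests on the Jacobi triple product.  Hence F is a constant
   divided by k_(3/5,3/5) k_(3/5,-3/5).  Klein forms satisfy k_v(M tau) = k_(v M)(tau) / (c tau + d) for
   every M in SL(2,Z), and translating v by an integer vector multiplies k_v by an explicit root of
   unity.  For M in the given group, v M agrees up to sign and an integer translation with one of the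
   two vectors, which yields the multiplier.  The inversion formula for Klein forms holds because
   the quotient of its two sides is an entire elliptic function, hence constant by Liouville. *)
theory Submission
  imports Defs "HOL-Complex_Analysis.Complex_Analysis" "HOL-Library.Periodic_Fun"
begin

subsection \<open>The Jacobi theta function as a product\<close>

text \<open>The obstacle is the multiplier: transforming eta under a general \<open>M\<close> brings
  in Dedekind sums, and inverting theta brings in a square root of tau. Klein forms avoid both. Each
  theta constant carries exactly one factor eta^3, so eta^6 cancels in \<open>F_fun\<close>; and the
  theta product is normalised to have derivative \<open>- (2 * pi * \<i>)\<close> at 0 for every
  tau, so comparing both sides of the inversion at 0 yields just 1/tau. Two forms of weight -1 in
  the denominator give weight 2. The triple product is needed because \<open>theta_char\<close> is a
  series, while the zeros are visible only on a product. The characteristics 1/5 and 9/5 give 3/5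
  and 7/5 = 2 - 3/5, hence the vectors 3/5 (1, 1) and 3/5 (1, -1). Modulo 5 the group permutes (1,
  1) and (1, -1) up to sign, and a correction by 5 (m, n) moves the Klein vector by the integers 3
  (m, n). The net sign is + for \<open>M\<close> congruent to I or -I and - otherwise, which
  explains the 5 in \<open>f_M\<close>.\<close>

definition ee :: "complex \<Rightarrow> complex" where
  "ee x = exp (2 * pi * \<i> * x)"

lemma ee_add: "ee (x + y) = ee x * ee y"
  by (simp add: ee_def distrib_left exp_add)

lemma ee_0 [simp]: "ee 0 = 1"
  by (simp add: ee_def)

lemma ee_nonzero [simp]: "ee x \<noteq> 0"
  by (simp add: ee_def)

lemma ee_minus: "ee (- x) = inverse (ee x)"
  by (simp add: ee_def exp_minus)

lemma ee_diff: "ee (x - y) = ee x / ee y"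
  by (simp add: ee_def right_diff_distrib exp_diff)

lemma ee_power: "ee x ^ n = ee (of_nat n * x)"
  by (simp add: ee_def mult_ac flip: exp_of_nat_mult)

lemma ee_eq_1_iff: "ee x = 1 \<longleftrightarrow> x \<in> \<int>"
proof
  assume "ee x = 1"
  then obtain n :: int where "2 * pi * \<i> * x = of_int (2 * n) * pi * \<i>"
    unfolding ee_def exp_eq_1 by (auto simp: complex_eq_iff)
  then have "x = of_int n" by simp
  then show "x \<in> \<int>" by simp
next
  assume "x \<in> \<int>"
  then obtain n where "x = of_int n" by (auto elim: Ints_cases)
  then show "ee x = 1"
    using exp_integer_2pi[of "of_int n"] by (simp add: ee_def mult_ac)
qed

lemma ee_of_int [simp]: "ee (of_int n) = 1"
  by (simp add: ee_eq_1_iff)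

lemma ee_1 [simp]: "ee 1 = 1"
  using ee_of_int[of 1] by simp

lemma ee_half: "ee (1 / 2) = -1"
  by (simp add: ee_def)

lemma norm_ee: "norm (ee x) = exp (- (2 * pi * Im x))"
  by (simp add: ee_def)

lemma norm_ee_less_1: "Im \<tau> > 0 \<Longrightarrow> norm (ee \<tau>) < 1"
  by (simp add: norm_ee)

lemma ee_holomorphic [holomorphic_intros]:
  "f holomorphic_on A \<Longrightarrow> (\<lambda>z. ee (f z)) holomorphic_on A"
  unfolding ee_def by (intro holomorphic_intros)

lemma ee_tendsto [tendsto_intros]:
  "(f \<longlongrightarrow> l) F \<Longrightarrow> ((\<lambda>x. ee (f x)) \<longlongrightarrow> ee l) F"
  unfolding ee_def by (intro tendsto_intros)

section \<open>The infinite q-Pochhammer symbol\<close>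

definition qpoch :: "complex \<Rightarrow> complex \<Rightarrow> complex" where
  "qpoch w q = (\<Prod>n. 1 - w * q ^ n)"

lemma has_prod_qpoch:
  assumes "norm q < 1"
  shows "(\<lambda>n. 1 - w * q ^ n) has_prod qpoch w q"
proof -
  have "summable (\<lambda>n. norm w * norm q ^ n)"
    using assms by (intro summable_mult summable_geometric) auto
  then have "abs_convergent_prod (\<lambda>n. 1 - w * q ^ n)"
    by (simp add: abs_convergent_prod_conv_summable norm_mult norm_power)
  then show ?thesis
    unfolding qpoch_def by (intro convergent_prod_has_prod abs_convergent_prod_imp_convergent_prod)
qed

lemma qpoch_LIMSEQ:
  assumes "norm q < 1"
  shows "(\<lambda>N. \<Prod>n<N. 1 - w * q ^ n) \<longlonglongrightarrow> qpoch w q"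
  using has_prod_qpoch[OF assms] has_prod_imp_tendsto' by blast

text \<open>A product convergent in the sense of \<open>has_prod\<close> vanishes only through one
  of its factors; this later locates the zeros of theta.\<close>

lemma qpoch_eq_0_iff:
  assumes "norm q < 1"
  shows "qpoch w q = 0 \<longleftrightarrow> (\<exists>n. w * q ^ n = 1)"
  using has_prod_eq_0_iff[OF has_prod_qpoch[OF assms, of w]]
  by (metis (no_types, lifting) rangeE rangeI right_minus_eq)

lemma qpoch_rec:
  assumes "norm q < 1"
  shows "qpoch w q = (1 - w) * qpoch (w * q) q"
proof (rule LIMSEQ_unique)
  show "(\<lambda>N. \<Prod>n<Suc N. 1 - w * q ^ n) \<longlonglongrightarrow> qpoch w q"
    using qpoch_LIMSEQ[OF assms] by (rule LIMSEQ_Suc)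
  show "(\<lambda>N. \<Prod>n<Suc N. 1 - w * q ^ n) \<longlonglongrightarrow> (1 - w) * qpoch (w * q) q"
    using tendsto_mult_left[OF qpoch_LIMSEQ[OF assms, of "w * q"], of "1 - w"]
    by (subst prod.lessThan_Suc_shift) (simp add: mult_ac)
qed

lemma qpoch_holomorphic_UNIV:
  assumes "norm q < 1"
  shows "(\<lambda>w. qpoch w q) holomorphic_on UNIV"
proof (rule holomorphic_uniform_sequence)
  show "(\<lambda>w. \<Prod>n<N. 1 - w * q ^ n) holomorphic_on UNIV" for N
    by (intro holomorphic_intros)
  fix x :: complex
  define X where "X = cball x 1"
  have "uniformly_convergent_on X (\<lambda>N w. \<Prod>n<N. 1 - w * q ^ n)"
  proof (rule uniformly_convergent_on_prod')
    show "uniformly_convergent_on X (\<lambda>N w. \<Sum>n<N. norm (1 - w * q ^ n - 1))"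
    proof (rule Weierstrass_m_test')
      fix n w assume "w \<in> X"
      then have "norm w \<le> norm x + 1"
        using norm_triangle_sub[of w x] by (simp add: X_def dist_norm norm_minus_commute)
      then show "norm (norm (1 - w * q ^ n - 1)) \<le> (norm x + 1) * norm q ^ n"
        by (simp add: norm_mult norm_power mult_right_mono)
    qed (use assms in \<open>intro summable_mult summable_geometric, simp\<close>)
  qed (auto simp: X_def intro!: continuous_intros)
  then obtain g where g: "uniform_limit X (\<lambda>N w. \<Prod>n<N. 1 - w * q ^ n) g sequentially"
    by (auto simp: uniformly_convergent_on_def)
  have "g w = qpoch w q" if "w \<in> X" for w
    using tendsto_uniform_limitI[OF g that] qpoch_LIMSEQ[OF assms] LIMSEQ_unique by blast
  then have "uniform_limit X (\<lambda>N w. \<Prod>n<N. 1 - w * q ^ n) (\<lambda>w. qpoch w q) sequentially"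
    using g by (simp cong: uniform_limit_cong')
  then show "\<exists>d>0. cball x d \<subseteq> UNIV \<and>
      uniform_limit (cball x d) (\<lambda>N w. \<Prod>n<N. 1 - w * q ^ n) (\<lambda>w. qpoch w q) sequentially"
    unfolding X_def by (intro exI[of _ 1]) auto
qed auto

lemma qpoch_holomorphic [holomorphic_intros]:
  assumes "norm q < 1" "f holomorphic_on A"
  shows "(\<lambda>z. qpoch (f z) q) holomorphic_on A"
  using holomorphic_on_compose_gen[OF assms(2) qpoch_holomorphic_UNIV[OF assms(1)]]
  by (simp add: o_def)

lemma qpoch_tendsto [tendsto_intros]:
  assumes "norm q < 1" "(f \<longlongrightarrow> l) F"
  shows "((\<lambda>x. qpoch (f x) q) \<longlongrightarrow> qpoch l q) F"
proof (rule isCont_tendsto_compose[OF _ assms(2)])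
  show "isCont (\<lambda>w. qpoch w q) l"
    using holomorphic_on_imp_continuous_on[OF qpoch_holomorphic_UNIV[OF assms(1)]]
    by (simp add: continuous_on_eq_continuous_at)
qed

section \<open>Quasi-periods and zeros of the theta product\<close>

definition lat :: "complex \<Rightarrow> complex set" where
  "lat \<tau> = {of_int m + of_int n * \<tau> | m n. True}"

text \<open>Up to a constant this is \<open>\<theta>\<^sub>1(z,\<tau>) / \<eta>(\<tau>)\<^sup>3\<close>; in this normalisation the derivative at \<open>z = 0\<close>
  does not depend on \<open>\<tau>\<close>.\<close>

definition theta_prod :: "complex \<Rightarrow> complex \<Rightarrow> complex" where
  "theta_prod z \<tau> =
     ee (- z / 2) * qpoch (ee z) (ee \<tau>) * qpoch (ee (\<tau> - z)) (ee \<tau>) / qpoch (ee \<tau>) (ee \<tau>) ^ 2"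

context
  fixes \<tau> :: complex
  assumes \<tau>: "Im \<tau> > 0"
begin

lemmas qpoch_ee_rec = qpoch_rec[OF norm_ee_less_1[OF \<tau>]]

lemma qpoch_ee_ee_nonzero: "qpoch (ee \<tau>) (ee \<tau>) \<noteq> 0"
proof
  assume "qpoch (ee \<tau>) (ee \<tau>) = 0"
  then obtain n where "ee \<tau> ^ Suc n = 1"
    using qpoch_eq_0_iff[OF norm_ee_less_1[OF \<tau>]] by auto
  then have "norm (ee \<tau>) ^ Suc n = 1" by (metis norm_one norm_power)
  then show False
    using norm_ee_less_1[OF \<tau>] power_Suc_less_one[of "norm (ee \<tau>)" n] by simp
qed

lemma theta_prod_holomorphic: "(\<lambda>z. theta_prod z \<tau>) holomorphic_on UNIV"
  unfolding theta_prod_def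
  by (intro holomorphic_intros norm_ee_less_1[OF \<tau>]) (auto simp: qpoch_ee_ee_nonzero)

lemma theta_prod_add_1: "theta_prod (z + 1) \<tau> = - theta_prod z \<tau>"
proof -
  have "ee (- (z + 1) / 2) = ee (- z / 2) / ee (1 / 2)"
    unfolding ee_diff[symmetric] by (rule arg_cong[of _ _ ee]) (simp add: field_simps)
  moreover have "ee (\<tau> - (z + 1)) = ee (\<tau> - z)"
    by (simp add: ee_diff ee_add)
  ultimately show ?thesis
    by (simp add: theta_prod_def ee_half ee_add)
qed

text \<open>Moving \<open>z\<close> by \<open>\<tau>\<close> removes the factor
  \<open>1 - ee z\<close> from the first product and adds \<open>1 - ee (- z)\<close> to the second.
  Their quotient \<open>- ee (- z)\<close> and the change of the prefactor make up the
  multiplier.\<close>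

lemma theta_prod_add_tau: "theta_prod (z + \<tau>) \<tau> = - ee (- \<tau> / 2 - z) * theta_prod z \<tau>"
proof -
  have 1: "qpoch (ee z) (ee \<tau>) = (1 - ee z) * qpoch (ee (z + \<tau>)) (ee \<tau>)"
    using qpoch_ee_rec[of "ee z"] by (simp add: ee_add)
  have 2: "qpoch (ee (\<tau> - (z + \<tau>))) (ee \<tau>) = (1 - ee (- z)) * qpoch (ee (\<tau> - z)) (ee \<tau>)"
    using qpoch_ee_rec[of "ee (- z)"] by (simp add: ee_add[symmetric])
  have 3: "1 - ee (- z) = - ee (- z) * (1 - ee z)"
    by (simp add: ee_minus field_simps)
  have 4: "ee (- (z + \<tau>) / 2) * ee (- z) = ee (- \<tau> / 2 - z) * ee (- z / 2)"
    unfolding ee_add[symmetric] by (rule arg_cong[of _ _ ee]) (simp add: field_simps)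
  show ?thesis
  proof -
    have "theta_prod (z + \<tau>) \<tau> = - (ee (- (z + \<tau>) / 2) * ee (- z)) * ((1 - ee z) *
        qpoch (ee (z + \<tau>)) (ee \<tau>) * qpoch (ee (\<tau> - z)) (ee \<tau>) / qpoch (ee \<tau>) (ee \<tau>) ^ 2)"
      unfolding theta_prod_def 2 3 by simp
    also have "\<dots> = - ee (- \<tau> / 2 - z) * theta_prod z \<tau>"
      unfolding 4 theta_prod_def 1 by simp
    finally show ?thesis .
  qed
qed

text \<open>Once the first factor is split off, the two remaining products are exchanged by
  \<open>z\<close> to \<open>- z\<close>, and \<open>ee (- z / 2) * (1 - ee z)\<close> is
  odd.\<close>

lemma theta_prod_minus: "theta_prod (- z) \<tau> = - theta_prod z \<tau>"
proof -
  have 1: "qpoch (ee z) (ee \<tau>) = (1 - ee z) * qpoch (ee (\<tau> + z)) (ee \<tau>)"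
    using qpoch_ee_rec[of "ee z"] by (simp add: ee_add mult_ac)
  have 2: "qpoch (ee (- z)) (ee \<tau>) = (1 - ee (- z)) * qpoch (ee (\<tau> - z)) (ee \<tau>)"
    using qpoch_ee_rec[of "ee (- z)"] by (simp add: ee_add[symmetric])
  have 3: "ee (z / 2) * (1 - ee (- z)) = - (ee (- z / 2) * (1 - ee z))"
    by (simp add: right_diff_distrib ee_add[symmetric] field_simps)
  show ?thesis
  proof -
    have "theta_prod (- z) \<tau> = ee (z / 2) * (1 - ee (- z)) *
        (qpoch (ee (\<tau> - z)) (ee \<tau>) * qpoch (ee (\<tau> + z)) (ee \<tau>) / qpoch (ee \<tau>) (ee \<tau>) ^ 2)"
      by (simp add: theta_prod_def 2)
    also have "\<dots> = - theta_prod z \<tau>"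
      by (simp add: 3 theta_prod_def 1)
    finally show ?thesis .
  qed
qed

text \<open>The first product vanishes at the lattice points with \<open>\<tau>\<close>-coefficient
  at most 0, the second at those with coefficient at least 1.\<close>

lemma theta_prod_eq_0_iff: "theta_prod z \<tau> = 0 \<longleftrightarrow> z \<in> lat \<tau>"
proof -
  have *: "ee x * ee \<tau> ^ n = 1 \<longleftrightarrow> (\<exists>m. x = of_int m - of_nat n * \<tau>)" for x n
    by (auto simp: ee_power ee_add[symmetric] ee_eq_1_iff algebra_simps elim!: Ints_cases)
  have "theta_prod z \<tau> = 0 \<longleftrightarrow>
      (\<exists>n m. z = of_int m - of_nat n * \<tau>) \<or> (\<exists>n m. \<tau> - z = of_int m - of_nat n * \<tau>)"
    using qpoch_ee_ee_nonzero
    by (simp add: theta_prod_def qpoch_eq_0_iff[OF norm_ee_less_1[OF \<tau>]] *)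
  also have "\<dots> \<longleftrightarrow> z \<in> lat \<tau>"
  proof
    assume "(\<exists>n m. z = of_int m - of_nat n * \<tau>) \<or> (\<exists>n m. \<tau> - z = of_int m - of_nat n * \<tau>)"
    then show "z \<in> lat \<tau>"
    proof (elim disjE exE)
      fix n m assume "z = of_int m - of_nat n * \<tau>"
      then have "z = of_int m + of_int (- int n) * \<tau>" by simp
      then show ?thesis unfolding lat_def by blast
    next
      fix n m assume "\<tau> - z = of_int m - of_nat n * \<tau>"
      then have "z = of_int (- m) + of_int (int n + 1) * \<tau>" by (simp add: algebra_simps)
      then show ?thesis unfolding lat_def by blast
    qed
  next
    assume "z \<in> lat \<tau>"
    then obtain m n where z: "z = of_int m + of_int n * \<tau>" by (auto simp: lat_def)
    show "(\<exists>n m. z = of_int m - of_nat n * \<tau>) \<or> (\<exists>n m. \<tau> - z = of_int m - of_nat n * \<tau>)"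
    proof (cases "n \<le> 0")
      case True
      then have "z = of_int m - of_nat (nat (- n)) * \<tau>" by (simp add: z)
      then show ?thesis by blast
    next
      case False
      then have "\<tau> - z = of_int (- m) - of_nat (nat (n - 1)) * \<tau>"
        by (simp add: z algebra_simps)
      then show ?thesis by blast
    qed
  qed
  finally show ?thesis .
qed

text \<open>The simple zero sits in \<open>1 - ee z\<close>; the remaining factors tend to
  \<open>Q ^ 2 / Q ^ 2 = 1\<close>.\<close>

lemma theta_prod_div_tendsto: "((\<lambda>z. theta_prod z \<tau> / z) \<longlongrightarrow> - (2 * pi * \<i>)) (at 0)"
proof -
  define Q where "Q = qpoch (ee \<tau>) (ee \<tau>)"
  have "((\<lambda>z. 1 - ee z) has_field_derivative - (2 * pi * \<i>)) (at 0)"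
    unfolding ee_def by (auto intro!: derivative_eq_intros)
  then have "((\<lambda>z. (1 - ee z) / z) \<longlongrightarrow> - (2 * pi * \<i>)) (at 0)"
    by (simp add: has_field_derivative_iff)
  moreover have "((\<lambda>z. ee (- z / 2) * (qpoch (ee (z + \<tau>)) (ee \<tau>) * qpoch (ee (\<tau> - z)) (ee \<tau>)) / Q ^ 2)
      \<longlongrightarrow> ee (- 0 / 2) * (qpoch (ee (0 + \<tau>)) (ee \<tau>) * qpoch (ee (\<tau> - 0)) (ee \<tau>)) / Q ^ 2) (at 0)"
    using qpoch_ee_ee_nonzero
    by (intro tendsto_intros norm_ee_less_1[OF \<tau>]) (auto simp: Q_def)
  ultimately have "((\<lambda>z. (1 - ee z) / z *
        (ee (- z / 2) * (qpoch (ee (z + \<tau>)) (ee \<tau>) * qpoch (ee (\<tau> - z)) (ee \<tau>)) / Q ^ 2))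
      \<longlongrightarrow> - (2 * pi * \<i>) * 1) (at 0)"
    using qpoch_ee_ee_nonzero
    by (intro tendsto_mult) (auto simp: Q_def power2_eq_square)
  moreover have "theta_prod z \<tau> / z = (1 - ee z) / z *
        (ee (- z / 2) * (qpoch (ee (z + \<tau>)) (ee \<tau>) * qpoch (ee (\<tau> - z)) (ee \<tau>)) / Q ^ 2)" for z
    using qpoch_ee_rec[of "ee z"] by (simp add: ee_add theta_prod_def Q_def mult_ac)
  ultimately show ?thesis by simp
qed

end

subsection \<open>Klein forms\<close>

lemma lat_iff: "z \<in> lat \<tau> \<longleftrightarrow> (\<exists>m n. z = of_int m + of_int n * \<tau>)"
  by (simp add: lat_def)

lemma lat_add: "z + of_int m + of_int n * \<tau> \<in> lat \<tau> \<longleftrightarrow> z \<in> lat \<tau>"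
proof
  assume "z + of_int m + of_int n * \<tau> \<in> lat \<tau>"
  then obtain i j where "z + of_int m + of_int n * \<tau> = of_int i + of_int j * \<tau>"
    by (auto simp: lat_iff)
  then have "z = of_int (i - m) + of_int (j - n) * \<tau>" by (simp add: algebra_simps)
  then show "z \<in> lat \<tau>" unfolding lat_iff by blast
next
  assume "z \<in> lat \<tau>"
  then obtain i j where "z = of_int i + of_int j * \<tau>" by (auto simp: lat_iff)
  then have "z + of_int m + of_int n * \<tau> = of_int (i + m) + of_int (j + n) * \<tau>"
    by (simp add: algebra_simps)
  then show "z + of_int m + of_int n * \<tau> \<in> lat \<tau>" unfolding lat_iff by blast
qed

text \<open>Subtracting the floors of the two real coordinates moves any point into the compact
  period parallelogram \<open>R\<close>, so \<open>h\<close> is bounded and Liouville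
  applies.\<close>

lemma doubly_periodic_entire_constant:
  fixes h :: "complex \<Rightarrow> complex"
  assumes \<tau>: "Im \<tau> > 0" and hol: "h holomorphic_on UNIV"
    and per: "\<And>z m n. h (z + of_int m + of_int n * \<tau>) = h z"
  shows "h z = h w"
proof -
  define R where "R = (\<lambda>(x, y). of_real x + of_real y * \<tau>) ` ({0..1::real} \<times> {0..1::real})"
  have "compact R"
    unfolding R_def case_prod_unfold
    by (intro compact_continuous_image continuous_intros compact_Times compact_Icc)
  then have "bounded (h ` R)"
    by (intro compact_imp_bounded compact_continuous_image)
      (auto intro: continuous_on_subset holomorphic_on_imp_continuous_on[OF hol])
  moreover have "range h \<subseteq> h ` R"
  proof safe
    fix z
    define y where "y = Im z / Im \<tau>"
    define x where "x = Re z - y * Re \<tau>"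
    have z: "z = of_real x + of_real y * \<tau>"
      using \<tau> by (simp add: complex_eq_iff x_def y_def)
    have "of_real (frac x) + of_real (frac y) * \<tau> = z + of_int (- \<lfloor>x\<rfloor>) + of_int (- \<lfloor>y\<rfloor>) * \<tau>"
      by (simp add: z frac_def algebra_simps)
    then have "h z = h (of_real (frac x) + of_real (frac y) * \<tau>)"
      by (simp only: per)
    moreover have "of_real (frac x) + of_real (frac y) * \<tau> \<in> R"
      unfolding R_def by (rule image_eqI[of _ _ "(frac x, frac y)"]) (auto simp: less_imp_le[OF frac_lt_1])
    ultimately show "h z \<in> h ` R" by blast
  qed
  ultimately have "bounded (range h)" by (rule bounded_subset)
  then have "h constant_on UNIV" using hol by (rule Liouville_theorem[rotated])
  then show ?thesis by (auto simp: constant_on_def)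
qed

text \<open>The multipliers cancel in \<open>A / B\<close>, so it is elliptic with singularities
  only at lattice points. The limit makes the one at 0 removable, and periodicity carries this to
  all others.\<close>

lemma quasi_periodic_proportional:
  fixes A B :: "complex \<Rightarrow> complex"
  assumes \<tau>: "Im \<tau> > 0"
    and holA: "A holomorphic_on UNIV" and holB: "B holomorphic_on UNIV"
    and A1: "\<And>z. A (z + 1) = \<mu> z * A z" and B1: "\<And>z. B (z + 1) = \<mu> z * B z"
    and A2: "\<And>z. A (z + \<tau>) = \<nu> z * A z" and B2: "\<And>z. B (z + \<tau>) = \<nu> z * B z"
    and mult: "\<And>z. \<mu> z \<noteq> 0" "\<And>z. \<nu> z \<noteq> 0"
    and zero: "\<And>z. B z = 0 \<longleftrightarrow> z \<in> lat \<tau>"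
    and ev: "eventually (\<lambda>z. B z \<noteq> 0) (at 0)"
    and lim: "((\<lambda>z. A z / B z) \<longlongrightarrow> c) (at 0)"
    and z: "z \<notin> lat \<tau>"
  shows "A z = c * B z"
proof -
  \<comment> \<open>Plain division would give 0 at the zeros of \<open>B\<close>; \<open>c\<close>
    is the value that makes \<open>h\<close> continuous there.\<close>
  define h where "h = (\<lambda>z. if z \<in> lat \<tau> then c else A z / B z)"
  have 0: "0 \<in> lat \<tau>"
    unfolding lat_iff by (intro exI[of _ 0]) simp
  have "h (z + 1) = h z" for z
    using lat_add[of z 1 0 \<tau>] mult by (simp add: h_def A1 B1)
  then interpret p1: periodic_fun_simple' h
    by unfold_locales
  have "h (z + \<tau>) = h z" for z
    using lat_add[of z 0 1 \<tau>] mult by (simp add: h_def A2 B2)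
  then interpret p2: periodic_fun_simple h \<tau>
    by unfold_locales
  have per: "h (z + of_int m + of_int n * \<tau>) = h z" for z m n
    by (simp add: p1.plus_of_int p2.plus_of_int)
  have op: "open {z. B z \<noteq> 0}"
    using holomorphic_on_imp_continuous_on[OF holB]
    by (intro open_Collect_neq continuous_on_const) auto
  have hol1: "h holomorphic_on {z. B z \<noteq> 0}"
  proof (rule holomorphic_transform)
    show "(\<lambda>z. A z / B z) holomorphic_on {z. B z \<noteq> 0}"
      by (intro holomorphic_on_divide) (auto intro: holomorphic_on_subset holA holB)
  qed (auto simp: h_def zero)
  obtain r where r: "r > 0" "\<And>z. z \<noteq> 0 \<Longrightarrow> dist z 0 < r \<Longrightarrow> B z \<noteq> 0"
    using ev unfolding eventually_at by auto
  have hol2: "h holomorphic_on ball 0 r"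
  proof (rule no_isolated_singularity')
    fix x :: complex assume "x \<in> {0}"
    have "eventually (\<lambda>z. A z / B z = h z) (at 0)"
      using ev by eventually_elim (simp add: h_def zero)
    then have "(h \<longlongrightarrow> c) (at 0)"
      using lim by (rule Lim_transform_eventually[rotated])
    then have "(h \<longlongrightarrow> h 0) (at 0)" using 0 by (simp add: h_def)
    then show "(h \<longlongrightarrow> h x) (at x within ball 0 r)"
      using \<open>x \<in> {0}\<close> by (auto intro: tendsto_within_subset)
  next
    show "h holomorphic_on ball 0 r - {0}"
      by (rule holomorphic_on_subset[OF hol1]) (use r(2) in \<open>auto simp: dist_commute\<close>)
  qed auto
  have "h field_differentiable at w" for w
  proof (cases "w \<in> lat \<tau>")
    case False
    then show ?thesis
      using hol1 op by (intro holomorphic_on_imp_differentiable_at) (auto simp: zero)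
  next
    case True
    then obtain m n where w: "w = of_int m + of_int n * \<tau>" by (auto simp: lat_iff)
    have "h (z + - w) = h z" for z
      using per[of z "- m" "- n"] by (simp add: w algebra_simps)
    moreover have "(\<lambda>z. h (z + - w)) field_differentiable at w"
      using holomorphic_on_imp_differentiable_at[OF hol2, of 0] r(1)
      by (intro field_differentiable_compose[of "\<lambda>z. z + - w" _ h, unfolded o_def]
           field_differentiable_add field_differentiable_ident field_differentiable_const) auto
    ultimately show ?thesis by simp
  qed
  then have "h holomorphic_on UNIV" by (simp add: holomorphic_on_def)
  then have "h z = h 0" by (rule doubly_periodic_entire_constant[OF \<tau> _ per])
  then show ?thesis using z 0 by (simp add: h_def zero[symmetric] field_simps)
qed

lemma Im_neg_inverse_pos: "Im \<tau> > 0 \<Longrightarrow> Im (- 1 / \<tau>) > 0"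
  by (simp add: Im_divide field_simps) (metis add_pos_nonneg divide_pos_pos zero_le_power2 zero_less_power)

lemma theta_prod_eventually_nonzero:
  assumes "Im \<tau> > 0"
  shows "eventually (\<lambda>z. theta_prod z \<tau> \<noteq> 0) (at 0)"
proof -
  have "eventually (\<lambda>z. theta_prod z \<tau> / z \<noteq> 0) (at 0)"
    using theta_prod_div_tendsto[OF assms] by (rule tendsto_imp_eventually_ne) simp
  then show ?thesis by eventually_elim auto
qed

text \<open>Division by \<open>\<tau>\<close> exchanges the roles of the periods 1 and
  \<open>\<tau>\<close>, and the Gaussian factor repairs the multipliers. At lattice points, which
  \<open>quasi_periodic_proportional\<close> excludes, both sides vanish.\<close>

lemma theta_prod_inversion:
  assumes \<tau>: "Im \<tau> > 0"
  shows "theta_prod (z / \<tau>) (- 1 / \<tau>) = ee (z ^ 2 / (2 * \<tau>)) * theta_prod z \<tau> / \<tau>"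
proof (cases "z \<in> lat \<tau>")
  case True
  have nz: "\<tau> \<noteq> 0" using \<tau> by auto
  obtain m n where z: "z = of_int m + of_int n * \<tau>" using True by (auto simp: lat_iff)
  have "z / \<tau> = of_int n + of_int (- m) * (- 1 / \<tau>)"
    using nz by (simp add: z field_simps)
  then have "z / \<tau> \<in> lat (- 1 / \<tau>)" unfolding lat_iff by blast
  then have "theta_prod (z / \<tau>) (- 1 / \<tau>) = 0"
    using theta_prod_eq_0_iff[OF Im_neg_inverse_pos[OF \<tau>]] by blast
  moreover have "theta_prod z \<tau> = 0"
    using True theta_prod_eq_0_iff[OF \<tau>] by blast
  ultimately show ?thesis by simp
next
  case False
  define \<tau>' where "\<tau>' = - 1 / \<tau>"
  have \<tau>': "Im \<tau>' > 0" using Im_neg_inverse_pos[OF \<tau>] by (simp add: \<tau>'_def)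
  have nz: "\<tau> \<noteq> 0" using \<tau> by auto
  \<comment> \<open>The left side with the Gaussian moved across; the factor \<open>\<tau>\<close>
    makes \<open>A z / theta_prod z \<tau>\<close> tend to 1 at 0.\<close>
  define A where "A = (\<lambda>z. theta_prod (z / \<tau>) \<tau>' * ee (- (z ^ 2 / (2 * \<tau>))) * \<tau>)"
  have "A z = 1 * theta_prod z \<tau>"
  proof (rule quasi_periodic_proportional[where A = A and B = "\<lambda>z. theta_prod z \<tau>" and c = 1 and z = z and \<tau> = \<tau>
        and \<mu> = "\<lambda>_. -1" and \<nu> = "\<lambda>z. - ee (- \<tau> / 2 - z)"])
    have "(\<lambda>z. theta_prod (z / \<tau>) \<tau>') holomorphic_on UNIV"
      using nz by (intro holomorphic_on_compose_gen[OF _ theta_prod_holomorphic[OF \<tau>'], unfolded o_def]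
          holomorphic_intros) auto
    then show "A holomorphic_on UNIV"
      unfolding A_def using nz by (intro holomorphic_intros) auto
    show "A (z + 1) = - 1 * A z" for z
    proof -
      \<comment> \<open>Since \<open>z / \<tau> = (z + 1) / \<tau> + \<tau>'\<close>, the
        quasi-period \<open>\<tau>'\<close> is used at the point
        \<open>(z + 1) / \<tau>\<close>.\<close>
      have "theta_prod (z / \<tau>) \<tau>' = - ee (- \<tau>' / 2 - (z + 1) / \<tau>) * theta_prod ((z + 1) / \<tau>) \<tau>'"
        using theta_prod_add_tau[OF \<tau>', of "(z + 1) / \<tau>"] by (simp add: \<tau>'_def add_divide_distrib)
      moreover have "ee (- ((z + 1) ^ 2 / (2 * \<tau>))) =
          ee (- \<tau>' / 2 - (z + 1) / \<tau>) * ee (- (z ^ 2 / (2 * \<tau>)))"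
        unfolding ee_add[symmetric] using nz
        by (intro arg_cong[of _ _ ee]) (simp add: \<tau>'_def field_simps power2_eq_square)
      ultimately show ?thesis by (simp add: A_def)
    qed
    show "A (z + \<tau>) = - ee (- \<tau> / 2 - z) * A z" for z
    proof -
      have "theta_prod ((z + \<tau>) / \<tau>) \<tau>' = - theta_prod (z / \<tau>) \<tau>'"
        using theta_prod_add_1[OF \<tau>', of "z / \<tau>"] nz by (simp add: add_divide_distrib)
      moreover have "ee (- ((z + \<tau>) ^ 2 / (2 * \<tau>))) = ee (- \<tau> / 2 - z) * ee (- (z ^ 2 / (2 * \<tau>)))"
        unfolding ee_add[symmetric] using nz
        by (intro arg_cong[of _ _ ee]) (simp add: field_simps power2_eq_square)
      ultimately show ?thesis by (simp add: A_def)
    qed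
    have "((\<lambda>z. theta_prod (z / \<tau>) \<tau>' / (z / \<tau>)) \<longlongrightarrow> - (2 * pi * \<i>)) (at 0)"
    proof (rule filterlim_compose[OF theta_prod_div_tendsto[OF \<tau>']])
      have "((\<lambda>z. z / \<tau>) \<longlongrightarrow> 0 / \<tau>) (at 0)" using nz by (intro tendsto_intros)
      then show "filterlim (\<lambda>z. z / \<tau>) (at 0) (at 0)"
        using nz by (auto simp: filterlim_at eventually_at_filter)
    qed
    moreover have "((\<lambda>z. ee (- (z ^ 2 / (2 * \<tau>)))) \<longlongrightarrow> ee (- (0 ^ 2 / (2 * \<tau>)))) (at 0)"
      using nz by (intro tendsto_intros) auto
    ultimately have "((\<lambda>z. theta_prod (z / \<tau>) \<tau>' / (z / \<tau>) * ee (- (z ^ 2 / (2 * \<tau>))) / (theta_prod z \<tau> / z))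
        \<longlongrightarrow> - (2 * pi * \<i>) * ee (- (0 ^ 2 / (2 * \<tau>))) / - (2 * pi * \<i>)) (at 0)"
      by (intro tendsto_divide tendsto_mult theta_prod_div_tendsto[OF \<tau>]) auto
    moreover have "eventually (\<lambda>z. theta_prod (z / \<tau>) \<tau>' / (z / \<tau>) * ee (- (z ^ 2 / (2 * \<tau>))) / (theta_prod z \<tau> / z)
        = A z / theta_prod z \<tau>) (at 0)"
      using eventually_neq_at_within[of 0 0] by eventually_elim (simp add: A_def)
    ultimately have "((\<lambda>z. A z / theta_prod z \<tau>) \<longlongrightarrow>
        - (2 * pi * \<i>) * ee (- (0 ^ 2 / (2 * \<tau>))) / - (2 * pi * \<i>)) (at 0)"
      by (rule Lim_transform_eventually)
    then show "((\<lambda>z. A z / theta_prod z \<tau>) \<longlongrightarrow> 1) (at 0)" by simp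
  qed (use \<tau> False theta_prod_holomorphic theta_prod_add_1 theta_prod_add_tau theta_prod_eq_0_iff
      theta_prod_eventually_nonzero in auto)
  then have "ee (z ^ 2 / (2 * \<tau>)) * theta_prod z \<tau> =
      theta_prod (z / \<tau>) \<tau>' * \<tau> * (ee (z ^ 2 / (2 * \<tau>)) * ee (- (z ^ 2 / (2 * \<tau>))))"
    by (simp add: A_def mult_ac)
  then show ?thesis using nz by (simp add: \<tau>'_def ee_minus)
qed

section \<open>Modular and translation behaviour of Klein forms\<close>

text \<open>The classical Klein form up to the constant -1/(2 pi i). The prefactor is the one that
  absorbs the Gaussian factor in the inversion of theta.\<close>

definition klein_form :: "complex \<Rightarrow> complex \<Rightarrow> complex \<Rightarrow> complex" where
  "klein_form r s \<tau> = ee (r * (r * \<tau> + s) / 2) * theta_prod (r * \<tau> + s) \<tau>"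

lemma klein_form_minus:
  assumes "Im \<tau> > 0"
  shows "klein_form (- r) (- s) \<tau> = - klein_form r s \<tau>"
  using theta_prod_minus[OF assms, of "r * \<tau> + s"] by (simp add: klein_form_def algebra_simps)

text \<open>\<open>theta_prod\<close> sees its modulus only through \<open>ee\<close>, which has
  period 1, and \<open>r * (\<tau> + n) + s = r * \<tau> + (s + r * n)\<close>.\<close>

lemma klein_form_translation: "klein_form r s (\<tau> + of_int n) = klein_form r (s + r * of_int n) \<tau>"
  by (simp add: klein_form_def theta_prod_def ee_add ee_diff algebra_simps)

lemma klein_form_inversion:
  assumes \<tau>: "Im \<tau> > 0"
  shows "klein_form r s (- 1 / \<tau>) = klein_form s (- r) \<tau> / \<tau>"
proof -
  have nz: "\<tau> \<noteq> 0" using \<tau> by auto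
  define z where "z = s * \<tau> + - r"
  have z: "r * (- 1 / \<tau>) + s = z / \<tau>" using nz by (simp add: z_def field_simps)
  \<comment> \<open>Here \<open>z + r = s * \<tau>\<close>, so the exponents add up to
    \<open>s * z / 2\<close>.\<close>
  have "ee (r * (z / \<tau>) / 2) * ee (z ^ 2 / (2 * \<tau>)) = ee (s * z / 2)"
    unfolding ee_add[symmetric] using nz
    by (intro arg_cong[of _ _ ee]) (simp add: z_def field_simps power2_eq_square)
  then show ?thesis
    unfolding klein_form_def z z_def[symmetric] theta_prod_inversion[OF \<tau>]
    by (simp add: mult.assoc[symmetric])
qed

lemma int_multiple_add_nonzero:
  fixes c d :: int
  assumes "Im \<tau> > 0" "c \<noteq> 0 \<or> d \<noteq> 0"
  shows "of_int c * \<tau> + of_int d \<noteq> 0"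
  using assms by (auto simp: complex_eq_iff)

text \<open>Euclidean algorithm on the lower row. With \<open>k = d div c\<close>, S the inversion
  and T the unit translation, M = M' S T^k, where M' has rows \<open>(k * a - b, a)\<close> and
  \<open>(k * c - d, c)\<close>. Its lower left entry is \<open>- (d mod c)\<close>, smaller in
  absolute value than \<open>c\<close>; the induction hypothesis is used at
  \<open>- 1 / \<tau>1\<close>, so \<open>\<tau>\<close> must be arbitrary.\<close>

lemma klein_form_modular:
  fixes a b c d :: int
  assumes "a * d - b * c = 1" and "Im \<tau> > 0"
  shows "klein_form r s ((of_int a * \<tau> + of_int b) / (of_int c * \<tau> + of_int d)) =
    klein_form (r * of_int a + s * of_int c) (r * of_int b + s * of_int d) \<tau> / (of_int c * \<tau> + of_int d)"
  using assms
proof (induction "nat \<bar>c\<bar>" arbitrary: a b c d \<tau> r s rule: less_induct)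
  case less
  show ?case
  proof (cases "c = 0")
    case True
    then have "a * d = 1" using less.prems by simp
    then consider "a = 1" "d = 1" | "a = -1" "d = -1"
      using zmult_eq_1_iff by blast
    then show ?thesis
    proof cases
      case 1
      then show ?thesis using True klein_form_translation[of r s \<tau> b] by (simp add: add.commute)
    next
      \<comment> \<open>The map is again a translation; the sign of the denominator is matched by
        the oddness of \<open>klein_form\<close> in \<open>(r, s)\<close>.\<close>
      case 2
      then show ?thesis
        using True klein_form_translation[of r s \<tau> "- b"]
          klein_form_minus[OF less.prems(2), of r "s - r * of_int b"]
        by (simp add: algebra_simps)
    qed
  next
    case False
    define k where "k = d div c"
    define \<tau>1 where "\<tau>1 = \<tau> + of_int k"
    have \<tau>1: "Im \<tau>1 > 0" using less.prems by (simp add: \<tau>1_def)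
    then have nz: "\<tau>1 \<noteq> 0" by auto
    have "k * c - d = - (d mod c)"
      by (simp add: k_def minus_mod_eq_div_mult[symmetric])
    then have "nat \<bar>k * c - d\<bar> < nat \<bar>c\<bar>"
      using False abs_mod_less[of c d] by simp
    moreover have "(k * a - b) * c - a * (k * c - d) = 1"
      using less.prems by (simp add: algebra_simps)
    moreover have den: "of_int (k * c - d) * (- 1 / \<tau>1) + of_int c = (of_int c * \<tau> + of_int d) / \<tau>1"
      "of_int (k * a - b) * (- 1 / \<tau>1) + of_int a = (of_int a * \<tau> + of_int b) / \<tau>1"
      using nz by (simp_all add: \<tau>1_def field_simps)
    ultimately have "klein_form r s ((of_int a * \<tau> + of_int b) / \<tau>1 / ((of_int c * \<tau> + of_int d) / \<tau>1)) =
        klein_form (r * of_int (k * a - b) + s * of_int (k * c - d)) (r * of_int a + s * of_int c) (- 1 / \<tau>1) /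
        ((of_int c * \<tau> + of_int d) / \<tau>1)"
      using less.hyps[of "k * c - d" "k * a - b" c a "- 1 / \<tau>1" r s] Im_neg_inverse_pos[OF \<tau>1]
      unfolding den by (simp only:)
    moreover have "klein_form (r * of_int (k * a - b) + s * of_int (k * c - d)) (r * of_int a + s * of_int c) (- 1 / \<tau>1)
        = klein_form (r * of_int a + s * of_int c) (r * of_int b + s * of_int d) \<tau> / \<tau>1"
      unfolding klein_form_inversion[OF \<tau>1] unfolding \<tau>1_def klein_form_translation
      by (simp add: algebra_simps)
    ultimately show ?thesis using nz by simp
  qed
qed

lemma klein_form_add_1_right:
  assumes "Im \<tau> > 0"
  shows "klein_form r (s + 1) \<tau> = ee (1 / 2 + r / 2) * klein_form r s \<tau>"
  using theta_prod_add_1[OF assms, of "r * \<tau> + s"]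
  by (simp add: klein_form_def ee_add ee_half add_divide_distrib distrib_left add.assoc)

text \<open>Adding 1 to \<open>r\<close> moves the argument by \<open>\<tau>\<close>; the prefactor
  cancels the \<open>\<tau>\<close>-dependence of the theta multiplier.\<close>

lemma klein_form_add_1_left:
  assumes "Im \<tau> > 0"
  shows "klein_form (r + 1) s \<tau> = ee (1 / 2 - s / 2) * klein_form r s \<tau>"
proof -
  have "ee ((r + 1) * ((r + 1) * \<tau> + s) / 2) * ee (- \<tau> / 2 - (r * \<tau> + s)) =
      ee (- s / 2) * ee (r * (r * \<tau> + s) / 2)"
    unfolding ee_add[symmetric] by (intro arg_cong[of _ _ ee]) (simp add: field_simps)
  moreover have "theta_prod ((r + 1) * \<tau> + s) \<tau> =
      - ee (- \<tau> / 2 - (r * \<tau> + s)) * theta_prod (r * \<tau> + s) \<tau>"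
    using theta_prod_add_tau[OF assms, of "r * \<tau> + s"] by (simp add: algebra_simps)
  moreover have "ee (1 / 2 - s / 2) = - ee (- s / 2)"
    using ee_add[of "1 / 2" "- s / 2"] by (simp add: ee_half)
  ultimately show ?thesis by (simp add: klein_form_def)
qed

text \<open>The term \<open>m * n\<close> arises because the shift of \<open>s\<close> is carried
  out at the already shifted \<open>r + of_int m\<close>.\<close>

lemma klein_form_add_int:
  fixes m n :: int
  assumes "Im \<tau> > 0"
  shows "klein_form (r + of_int m) (s + of_int n) \<tau> =
    ee (of_int (m + n + m * n) / 2 + (r * of_int n - s * of_int m) / 2) * klein_form r s \<tau>"
proof -
  have right: "klein_form r (s + of_int n) \<tau> = ee (of_int n * (1 + r) / 2) * klein_form r s \<tau>" for r s n
  proof -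
    \<comment> \<open>Dividing out the expected phase leaves a function of period 1, so periodicity
      settles positive and negative integers at once.\<close>
    define g where "g x = ee (- x * (1 + r) / 2) * klein_form r (s + x) \<tau>" for x
    have "g (x + 1) = g x" for x
    proof -
      have "ee (- (x + 1) * (1 + r) / 2) * ee (1 / 2 + r / 2) = ee (- x * (1 + r) / 2)"
        unfolding ee_add[symmetric] by (intro arg_cong[of _ _ ee]) (simp add: field_simps)
      then show ?thesis
        using klein_form_add_1_right[OF assms, of r "s + x"]
        by (simp add: g_def add.assoc[symmetric] mult.assoc[symmetric])
    qed
    then interpret periodic_fun_simple' g by unfold_locales
    have "g (of_int n) = g 0" using plus_of_int[of 0 n] by simp
    moreover have "ee (of_int n * (1 + r) / 2) * ee (- of_int n * (1 + r) / 2) = 1"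
      unfolding ee_add[symmetric] by simp
    ultimately show ?thesis
      by (simp add: g_def) (metis mult.assoc mult_1)
  qed
  have left: "klein_form (r + of_int m) s \<tau> = ee (of_int m * (1 - s) / 2) * klein_form r s \<tau>" for r s m
  proof -
    define g where "g x = ee (- x * (1 - s) / 2) * klein_form (r + x) s \<tau>" for x
    have "g (x + 1) = g x" for x
    proof -
      have "ee (- (x + 1) * (1 - s) / 2) * ee (1 / 2 - s / 2) = ee (- x * (1 - s) / 2)"
        unfolding ee_add[symmetric] by (intro arg_cong[of _ _ ee]) (simp add: field_simps)
      then show ?thesis
        using klein_form_add_1_left[OF assms, of "r + x" s]
        by (simp add: g_def add.assoc[symmetric] mult.assoc[symmetric])
    qed
    then interpret periodic_fun_simple' g by unfold_locales
    have "g (of_int m) = g 0" using plus_of_int[of 0 m] by simp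
    moreover have "ee (of_int m * (1 - s) / 2) * ee (- of_int m * (1 - s) / 2) = 1"
      unfolding ee_add[symmetric] by simp
    ultimately show ?thesis
      by (simp add: g_def) (metis mult.assoc mult_1)
  qed
  show ?thesis
    unfolding right left mult.assoc[symmetric] ee_add[symmetric]
    by (intro arg_cong2[of _ _ _ _ "(*)"] arg_cong[of _ _ ee]) (simp_all add: field_simps)
qed

subsection \<open>The Jacobi triple product\<close>

definition qfact :: "complex \<Rightarrow> nat \<Rightarrow> complex" where
  "qfact q N = (\<Prod>n<N. 1 - q ^ Suc n)"

text \<open>Gaussian binomial coefficients by a Pascal rule, hence without division. Of the two such
  rules this is the one produced by multiplying with a new last factor. For \<open>j > N\<close> the
  truncated \<open>N - j\<close> is harmless, since the coefficient it multiplies is 0.\<close>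

fun qbinomial :: "complex \<Rightarrow> nat \<Rightarrow> nat \<Rightarrow> complex" where
  "qbinomial q N 0 = 1"
| "qbinomial q 0 (Suc j) = 0"
| "qbinomial q (Suc N) (Suc j) = qbinomial q N (Suc j) + q ^ (N - j) * qbinomial q N j"

lemma qbinomial_eq_0: "N < j \<Longrightarrow> qbinomial q N j = 0"
  by (induction q N j rule: qbinomial.induct) auto

lemma qbinomial_self [simp]: "qbinomial q N N = 1"
  by (induction N) (auto simp: qbinomial_eq_0)

text \<open>The factorial formula without division or subtraction; its induction step is
  \<open>(1 - q ^ i) + q ^ i * (1 - q ^ j) = 1 - q ^ (i + j)\<close>.\<close>

lemma qbinomial_qfact: "qbinomial q (i + j) j * qfact q j * qfact q i = qfact q (i + j)"
proof (induction "i + j" arbitrary: i j)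
  case 0
  then show ?case by (simp add: qfact_def)
next
  case (Suc N)
  consider "j = 0" | "i = 0" | i' j' where "i = Suc i'" "j = Suc j'"
    by (metis not0_implies_Suc)
  then show ?case
  proof cases
    case 3
    have IH1: "qbinomial q (i' + j) j * qfact q j * qfact q i' = qfact q (i' + j)"
      using Suc.hyps(1)[of i' j] Suc.hyps(2) 3 by simp
    have IH2: "qbinomial q (i' + j) j' * qfact q j' * qfact q i = qfact q (i' + j)"
      using Suc.hyps(1)[of i j'] Suc.hyps(2) 3 by simp
    have i: "qfact q i = qfact q i' * (1 - q ^ i)" and j: "qfact q j = qfact q j' * (1 - q ^ j)"
      by (simp_all add: qfact_def 3)
    have "qbinomial q (i + j) j = qbinomial q (i' + j) j + q ^ i * qbinomial q (i' + j) j'"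
      by (simp add: 3)
    then have "qbinomial q (i + j) j * qfact q j * qfact q i =
        (qbinomial q (i' + j) j * qfact q j * qfact q i') * (1 - q ^ i) +
        (qbinomial q (i' + j) j' * qfact q j' * qfact q i) * (q ^ i * (1 - q ^ j))"
      by (simp add: i j algebra_simps)
    also have "\<dots> = qfact q (i' + j) * (1 - q ^ (i + j))"
      unfolding IH1 IH2 by (simp add: power_add algebra_simps)
    also have "\<dots> = qfact q (i + j)"
      by (simp add: qfact_def 3)
    finally show ?thesis .
  qed (auto simp: qfact_def)
qed

lemma q_binomial_theorem:
  "(\<Prod>k<N. 1 + ee (y + of_nat k * \<tau>)) =
    (\<Sum>j\<le>N. qbinomial (ee \<tau>) N j * ee (of_nat j * (of_nat j - 1) / 2 * \<tau> + of_nat j * y))"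
proof (induction N)
  case 0
  then show ?case by simp
next
  case (Suc N)
  define E where "E j = ee (of_nat j * (of_nat j - 1) / 2 * \<tau> + of_nat j * y)" for j :: nat
  let ?b = "qbinomial (ee \<tau>)"
  \<comment> \<open>The Pascal weight fits because (N - j) + j(j + 1)/2 = N + j(j - 1)/2.\<close>
  have E: "ee \<tau> ^ (N - j) * E (Suc j) = ee (y + of_nat N * \<tau>) * E j" if "j \<le> N" for j
    unfolding E_def ee_power ee_add[symmetric] using that
    by (intro arg_cong[of _ _ ee]) (simp add: of_nat_diff field_simps)
  have "(\<Sum>j\<le>Suc N. ?b (Suc N) j * E j) = E 0 + (\<Sum>j\<le>N. ?b (Suc N) (Suc j) * E (Suc j))"
    by (subst sum.atMost_Suc_shift) simp
  also have "\<dots> = (E 0 + (\<Sum>j\<le>N. ?b N (Suc j) * E (Suc j))) +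
      (\<Sum>j\<le>N. ?b N j * (ee \<tau> ^ (N - j) * E (Suc j)))"
    by (simp add: sum.distrib distrib_right distrib_left mult_ac add.assoc)
  also have "E 0 + (\<Sum>j\<le>N. ?b N (Suc j) * E (Suc j)) = (\<Sum>j\<le>Suc N. ?b N j * E j)"
    by (subst sum.atMost_Suc_shift) simp
  also have "\<dots> = (\<Sum>j\<le>N. ?b N j * E j)"
    by (simp add: qbinomial_eq_0)
  also have "(\<Sum>j\<le>N. ?b N j * (ee \<tau> ^ (N - j) * E (Suc j))) =
      ee (y + of_nat N * \<tau>) * (\<Sum>j\<le>N. ?b N j * E j)"
    unfolding sum_distrib_left by (intro sum.cong refl) (simp add: E mult.left_commute)
  also have "(\<Sum>j\<le>N. ?b N j * E j) + ee (y + of_nat N * \<tau>) * (\<Sum>j\<le>N. ?b N j * E j) =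
      (\<Sum>j\<le>N. ?b N j * E j) * (1 + ee (y + of_nat N * \<tau>))"
    by (simp add: distrib_left mult.commute[of _ "ee (y + of_nat N * \<tau>)"])
  finally show ?case
    unfolding prod.lessThan_Suc Suc E_def[symmetric] ..
qed

text \<open>This is the \<open>q\<close>-binomial theorem for \<open>2n\<close> factors with \<open>y = z - n\<tau>\<close>, recentred by \<open>j = k + n\<close>.\<close>

lemma finite_jacobi_triple_product:
  "(\<Prod>k<n. 1 + ee z * ee \<tau> ^ k) * (\<Prod>k<n. 1 + ee (\<tau> - z) * ee \<tau> ^ k) =
    (\<Sum>k=-int n..int n. qbinomial (ee \<tau>) (2 * n) (nat (k + int n)) *
       ee (of_int k * (of_int k - 1) / 2 * \<tau> + of_int k * z))"
proof -
  define y where "y = z - of_nat n * \<tau>"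
  \<comment> \<open>Minus the sum of the exponents \<open>z - of_nat (Suc k) * \<tau>\<close> for
    \<open>k < n\<close>, which are pulled out of the lower half of the factors.\<close>
  define c where "c = of_nat n * (of_nat n + 1) / 2 * \<tau> - of_nat n * z"
  have split: "(\<Prod>k<n + n. f k) = (\<Prod>k<n. f (n - Suc k)) * (\<Prod>k<n. f (n + k))" for f :: "nat \<Rightarrow> complex"
  proof -
    have "(\<Prod>k<m + n. f k) = (\<Prod>k<m. f k) * (\<Prod>k<n. f (m + k))" for m
      by (induction n) (simp_all add: mult_ac)
    then show ?thesis by (simp add: prod.nat_diff_reindex)
  qed
  \<comment> \<open>This is 1 + x = x (1 + 1/x); the lower half is read backwards so that the powers
    \<open>ee \<tau> ^ k\<close> increase.\<close>
  have low: "1 + ee (y + of_nat (n - Suc k) * \<tau>) =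
      ee (z - of_nat (Suc k) * \<tau>) * (1 + ee (\<tau> - z) * ee \<tau> ^ k)" if "k < n" for k
  proof -
    have "y + of_nat (n - Suc k) * \<tau> = z - of_nat (Suc k) * \<tau>"
      using that by (simp add: y_def of_nat_diff algebra_simps)
    moreover have "ee (z - of_nat (Suc k) * \<tau>) * (ee (\<tau> - z) * ee \<tau> ^ k) = 1"
      unfolding ee_power ee_add[symmetric] by (simp add: algebra_simps)
    ultimately show ?thesis by (simp add: distrib_left)
  qed
  have high: "1 + ee (y + of_nat (n + k) * \<tau>) = 1 + ee z * ee \<tau> ^ k" for k
    unfolding ee_power ee_add[symmetric] by (simp add: y_def algebra_simps)
  have "ee c * (\<Prod>k<n. ee (z - of_nat (Suc k) * \<tau>)) = 1"
  proof -
    define P where "P n = (\<Prod>k<n. ee (z - of_nat (Suc k) * \<tau>))" for n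
    define c' where "c' n = of_nat n * (of_nat n + 1) / 2 * \<tau> - of_nat n * z" for n
    have "ee (c' n) * P n = 1"
    proof (induction n)
      case (Suc n)
      have "c' (Suc n) + (z - of_nat (Suc n) * \<tau>) = c' n"
        by (simp add: c'_def field_simps)
      then have "ee (c' (Suc n)) * ee (z - of_nat (Suc n) * \<tau>) = ee (c' n)"
        unfolding ee_add[symmetric] by (rule arg_cong)
      moreover have "P (Suc n) = ee (z - of_nat (Suc n) * \<tau>) * P n"
        by (simp add: P_def)
      ultimately show ?case using Suc by (simp only: mult.assoc[symmetric])
    qed (simp add: P_def c'_def)
    then show ?thesis by (simp only: c_def P_def c'_def)
  qed
  note c = this
  have "(\<Prod>k<n. 1 + ee (y + of_nat (n - Suc k) * \<tau>)) =
      (\<Prod>k<n. ee (z - of_nat (Suc k) * \<tau>)) * (\<Prod>k<n. 1 + ee (\<tau> - z) * ee \<tau> ^ k)"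
    unfolding prod.distrib[symmetric] by (intro prod.cong refl low) simp
  then have "ee c * (\<Prod>k<2 * n. 1 + ee (y + of_nat k * \<tau>)) =
      (ee c * (\<Prod>k<n. ee (z - of_nat (Suc k) * \<tau>))) *
      ((\<Prod>k<n. 1 + ee z * ee \<tau> ^ k) * (\<Prod>k<n. 1 + ee (\<tau> - z) * ee \<tau> ^ k))"
    unfolding mult_2 split high by (simp only: mult_ac)
  then have "(\<Prod>k<n. 1 + ee z * ee \<tau> ^ k) * (\<Prod>k<n. 1 + ee (\<tau> - z) * ee \<tau> ^ k) =
      ee c * (\<Prod>k<2 * n. 1 + ee (y + of_nat k * \<tau>))"
    unfolding c mult_1 by (rule sym)
  also have "\<dots> = (\<Sum>j\<le>2 * n. qbinomial (ee \<tau>) (2 * n) j *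
      (ee c * ee (of_nat j * (of_nat j - 1) / 2 * \<tau> + of_nat j * y)))"
    unfolding q_binomial_theorem by (simp add: sum_distrib_left mult_ac)
  also have "\<dots> = (\<Sum>k=-int n..int n. qbinomial (ee \<tau>) (2 * n) (nat (k + int n)) *
       ee (of_int k * (of_int k - 1) / 2 * \<tau> + of_int k * z))"
  proof (rule sum.reindex_bij_witness[of _ "\<lambda>k. nat (k + int n)" "\<lambda>j. int j - int n"], goal_cases)
    case (5 j)
    have "ee c * ee (of_nat j * (of_nat j - 1) / 2 * \<tau> + of_nat j * y) =
        ee (of_int (int j - int n) * (of_int (int j - int n) - 1) / 2 * \<tau> + of_int (int j - int n) * z)"
      unfolding ee_add[symmetric]
      by (intro arg_cong[of _ _ ee]) (simp add: c_def y_def field_simps)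
    then show ?case by simp
  qed auto
  finally show ?thesis .
qed

section \<open>Passage to the infinite triple product\<close>

text \<open>Tannery's theorem for sums over the integers, obtained by viewing them as integrals over
  counting measure.\<close>

lemma dominated_convergence_int:
  fixes f :: "nat \<Rightarrow> int \<Rightarrow> complex"
  assumes lim: "\<And>k. (\<lambda>n. f n k) \<longlonglongrightarrow> g k"
    and bound: "\<And>n k. norm (f n k) \<le> M k" and M: "M summable_on UNIV"
  shows "(\<lambda>n. infsum (f n) UNIV) \<longlonglongrightarrow> infsum g UNIV"
proof -
  have "M k \<ge> 0" for k using bound[of 0 k] norm_ge_zero order_trans by blast
  then have abs: "Infinite_Set_Sum.abs_summable_on M UNIV"
    using M by (simp add: abs_summable_equivalent[symmetric])
  have bg: "norm (g k) \<le> M k" for k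
    using lim[of k] by (rule Lim_norm_ubound[rotated]) (simp_all add: bound)
  have dom: "Infinite_Set_Sum.abs_summable_on h UNIV" if "\<And>k. norm (h k) \<le> M k" for h :: "int \<Rightarrow> complex"
    using abs by (rule Infinite_Set_Sum.abs_summable_on_comparison_test) (use that order_trans[OF _ abs_ge_self] in auto)
  have 1: "infsum (f n) UNIV = infsetsum (f n) UNIV" for n
    using bound by (intro infsetsum_infsum[symmetric] dom)
  have 2: "infsum g UNIV = infsetsum g UNIV"
    using bg by (intro infsetsum_infsum[symmetric] dom)
  show "(\<lambda>n. infsum (f n) UNIV) \<longlonglongrightarrow> infsum g UNIV"
    unfolding 1 2 infsetsum_def
    by (rule integral_dominated_convergence[where w = M])
      (use abs bound lim in \<open>auto simp: abs_summable_on_def\<close>)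
qed

lemma summable_on_int_power:
  fixes r :: real
  assumes "0 \<le> r" "r < 1"
  shows "(\<lambda>k::int. r ^ nat \<bar>k\<bar>) summable_on UNIV"
proof -
  have r: "(\<lambda>n. r ^ n) summable_on UNIV"
    using assms by (intro summable_nonneg_imp_summable_on) auto
  have 1: "(\<lambda>k::int. r ^ nat \<bar>k\<bar>) summable_on range int"
    using r by (subst summable_on_reindex) (auto simp: o_def)
  have 2: "(\<lambda>k::int. r ^ nat \<bar>k\<bar>) summable_on range (\<lambda>n. - int n)"
    using r by (subst summable_on_reindex) (auto simp: o_def inj_on_def)
  have "(\<lambda>k::int. r ^ nat \<bar>k\<bar>) summable_on (range int \<union> (range (\<lambda>n. - int n) - range int))"
    by (intro summable_on_Un_disjoint 1 summable_on_subset_banach[OF 2]) auto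
  moreover have "range int \<union> (range (\<lambda>n. - int n) - range int) = UNIV"
    by (auto simp: image_def) (metis int_cases2)
  ultimately show ?thesis by simp
qed

lemma summable_on_int_gaussian:
  fixes \<alpha> \<beta> :: real
  assumes "\<alpha> > 0"
  shows "(\<lambda>k::int. exp (- (\<alpha> * of_int k ^ 2 + \<beta> * of_int k))) summable_on UNIV"
proof -
  \<comment> \<open>Completes the square in
    \<open>\<alpha> * x ^ 2 - (\<bar>\<beta>\<bar> + 1) * x\<close>, so that the exponent is at most
    \<open>C - \<bar>k\<bar>\<close>.\<close>
  define C where "C = (\<bar>\<beta>\<bar> + 1) ^ 2 / (4 * \<alpha>)"
  have bound: "exp (- (\<alpha> * of_int k ^ 2 + \<beta> * of_int k)) \<le> exp C * exp (- 1) ^ nat \<bar>k\<bar>" for k :: int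
  proof -
    have "0 \<le> \<alpha> * (\<bar>of_int k\<bar> - (\<bar>\<beta>\<bar> + 1) / (2 * \<alpha>)) ^ 2"
      using assms by simp
    also have "\<dots> = \<alpha> * of_int k ^ 2 - (\<bar>\<beta>\<bar> + 1) * \<bar>of_int k\<bar> + C"
    proof -
      have "\<alpha> * (x - y / (2 * \<alpha>)) ^ 2 = \<alpha> * x ^ 2 - y * x + y ^ 2 / (4 * \<alpha>)" for x y
        using assms by (simp add: power2_eq_square field_simps)
      then show ?thesis by (simp add: C_def)
    qed
    finally have "0 \<le> \<alpha> * of_int k ^ 2 - (\<bar>\<beta>\<bar> + 1) * \<bar>of_int k\<bar> + C" .
    moreover have "- (\<beta> * of_int k) \<le> \<bar>\<beta>\<bar> * \<bar>of_int k\<bar>"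
      by (metis abs_ge_minus_self abs_mult)
    ultimately have "- (\<alpha> * of_int k ^ 2 + \<beta> * of_int k) \<le> C - \<bar>of_int k\<bar>"
      by (simp add: algebra_simps)
    moreover have "exp (- 1) ^ nat \<bar>k\<bar> = exp (- \<bar>of_int k\<bar> :: real)"
      by (simp flip: exp_of_nat_mult)
    ultimately show ?thesis by (simp flip: exp_add)
  qed
  have "(\<lambda>k::int. exp C * exp (- 1) ^ nat \<bar>k\<bar>) summable_on UNIV"
    by (intro summable_on_cmult_right summable_on_int_power) auto
  then show ?thesis
    by (rule summable_on_comparison_test) (use bound in auto)
qed

context
  fixes \<tau> :: complex
  assumes \<tau>: "Im \<tau> > 0"
begin

lemma qfact_LIMSEQ: "qfact (ee \<tau>) \<longlonglongrightarrow> qpoch (ee \<tau>) (ee \<tau>)"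
  using qpoch_LIMSEQ[OF norm_ee_less_1[OF \<tau>], of "ee \<tau>"] by (simp add: qfact_def[abs_def])

lemma qfact_nonzero: "qfact (ee \<tau>) N \<noteq> 0"
proof -
  have "ee \<tau> ^ Suc n \<noteq> 1" for n
    using norm_ee_less_1[OF \<tau>] power_Suc_less_one[of "norm (ee \<tau>)" n]
    by (metis less_irrefl norm_ge_zero norm_one norm_power norm_eq_zero ee_nonzero zero_less_norm_iff)
  then show ?thesis by (auto simp: qfact_def)
qed

lemma qbinomial_eq:
  assumes "j \<le> N"
  shows "qbinomial (ee \<tau>) N j = qfact (ee \<tau>) N / (qfact (ee \<tau>) j * qfact (ee \<tau>) (N - j))"
  using qbinomial_qfact[of "ee \<tau>" "N - j" j] assms qfact_nonzero by (simp add: field_simps)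

text \<open>\<open>qfact\<close> converges to a nonzero limit, so it and its inverse are bounded.
  The bound, uniform in both indices, supplies the dominating series.\<close>

lemma qbinomial_bounded: "\<exists>C. \<forall>N j. norm (qbinomial (ee \<tau>) N j) \<le> C"
proof -
  have "Bseq (qfact (ee \<tau>))"
    using qfact_LIMSEQ by (intro convergent_imp_Bseq convergentI)
  then obtain K where K: "K > 0" "\<And>n. norm (qfact (ee \<tau>) n) \<le> K"
    by (auto elim: BseqE)
  have "Bseq (\<lambda>n. inverse (qfact (ee \<tau>) n))"
    using tendsto_inverse[OF qfact_LIMSEQ qpoch_ee_ee_nonzero[OF \<tau>]]
    by (intro convergent_imp_Bseq) (rule convergentI)
  then obtain L where L: "L > 0" "\<And>n. norm (inverse (qfact (ee \<tau>) n)) \<le> L"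
    by (auto elim: BseqE)
  have "norm (qbinomial (ee \<tau>) N j) \<le> K * (L * L)" for N j
  proof (cases "j \<le> N")
    case True
    have "norm (qbinomial (ee \<tau>) N j) = norm (qfact (ee \<tau>) N) *
        (norm (inverse (qfact (ee \<tau>) j)) * norm (inverse (qfact (ee \<tau>) (N - j))))"
      by (simp add: qbinomial_eq[OF True] norm_divide norm_mult norm_inverse divide_inverse)
    also have "\<dots> \<le> K * (L * L)"
      using K L by (intro mult_mono mult_nonneg_nonneg) (auto simp del: norm_inverse intro: less_imp_le)
    finally show ?thesis .
  next
    case False
    then show ?thesis using K L by (simp add: qbinomial_eq_0)
  qed
  then show ?thesis by blast
qed

text \<open>Both \<open>n + k\<close> and \<open>n - k\<close> tend to infinity, so all three
  \<open>qfact\<close> values tend to the same limit.\<close>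

lemma qbinomial_central_LIMSEQ:
  "(\<lambda>n. qbinomial (ee \<tau>) (2 * n) (nat (k + int n))) \<longlonglongrightarrow> 1 / qpoch (ee \<tau>) (ee \<tau>)"
proof -
  let ?Q = "qpoch (ee \<tau>) (ee \<tau>)"
  have "(\<lambda>n. qfact (ee \<tau>) (2 * n) / (qfact (ee \<tau>) (nat (k + int n)) * qfact (ee \<tau>) (nat (int n - k))))
      \<longlonglongrightarrow> ?Q / (?Q * ?Q)"
  proof (intro tendsto_intros)
    have "filterlim (\<lambda>n::nat. 2 * n) at_top sequentially"
      by (rule filterlim_at_top_mono[OF filterlim_ident]) auto
    then show "(\<lambda>n. qfact (ee \<tau>) (2 * n)) \<longlonglongrightarrow> ?Q"
      by (rule filterlim_compose[OF qfact_LIMSEQ])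
    have "filterlim (\<lambda>n. nat (i + int n)) at_top sequentially" for i
      unfolding filterlim_at_top eventually_sequentially
    proof
      fix Z
      show "\<exists>N. \<forall>n\<ge>N. Z \<le> nat (i + int n)" by (intro exI[of _ "Z + nat \<bar>i\<bar>"]) auto
    qed
    from this[of k] this[of "- k"]
    show "(\<lambda>n. qfact (ee \<tau>) (nat (k + int n))) \<longlonglongrightarrow> ?Q"
      "(\<lambda>n. qfact (ee \<tau>) (nat (int n - k))) \<longlonglongrightarrow> ?Q"
      by (auto intro: filterlim_compose[OF qfact_LIMSEQ])
  qed (simp add: qpoch_ee_ee_nonzero[OF \<tau>])
  moreover have "eventually (\<lambda>n. qfact (ee \<tau>) (2 * n) /
      (qfact (ee \<tau>) (nat (k + int n)) * qfact (ee \<tau>) (nat (int n - k))) =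
      qbinomial (ee \<tau>) (2 * n) (nat (k + int n))) sequentially"
    using eventually_ge_at_top[of "nat \<bar>k\<bar>"]
  proof eventually_elim
    case (elim n)
    then have "nat (k + int n) \<le> 2 * n" "2 * n - nat (k + int n) = nat (int n - k)" by auto
    then show ?case by (simp add: qbinomial_eq)
  qed
  ultimately show ?thesis
    using qpoch_ee_ee_nonzero[OF \<tau>] by (auto dest: Lim_transform_eventually)
qed

lemma jacobi_triple_product:
  "(\<Sum>\<^sub>\<infinity>k::int. ee (of_int k * (of_int k - 1) / 2 * \<tau> + of_int k * z)) =
    qpoch (- ee z) (ee \<tau>) * qpoch (- ee (\<tau> - z)) (ee \<tau>) * qpoch (ee \<tau>) (ee \<tau>)"
proof -
  define E where "E k = ee (of_int k * (of_int k - 1) / 2 * \<tau> + of_int k * z)" for k :: int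
  let ?Q = "qpoch (ee \<tau>) (ee \<tau>)"
  \<comment> \<open>Extension by 0 turns the finite sums into sums over all integers with the common
    majorant \<open>C * norm (E k)\<close>.\<close>
  define f where "f n k = (if k \<in> {- int n..int n} then qbinomial (ee \<tau>) (2 * n) (nat (k + int n)) else 0) * E k"
    for n k
  obtain C where C: "\<And>N j. norm (qbinomial (ee \<tau>) N j) \<le> C"
    using qbinomial_bounded by blast
  then have "C \<ge> 0" using norm_ge_zero order_trans by blast
  have "(\<lambda>k. norm (E k)) summable_on UNIV"
  proof -
    have "norm (E k) = exp (- (pi * Im \<tau> * of_int k ^ 2 + (2 * pi * Im z - pi * Im \<tau>) * of_int k))" for k
      by (simp add: E_def norm_ee power2_eq_square field_simps)
    moreover have "(\<lambda>k::int. exp (- (pi * Im \<tau> * of_int k ^ 2 + (2 * pi * Im z - pi * Im \<tau>) * of_int k)))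
        summable_on UNIV"
      using \<tau> by (intro summable_on_int_gaussian) simp
    ultimately show ?thesis by presburger
  qed
  then have sum: "(\<lambda>k. C * norm (E k)) summable_on UNIV"
    by (rule summable_on_cmult_right)
  have bound: "norm (f n k) \<le> C * norm (E k)" for n k
    using C \<open>C \<ge> 0\<close> by (auto simp: f_def norm_mult intro!: mult_right_mono)
  have lim: "(\<lambda>n. f n k) \<longlonglongrightarrow> 1 / ?Q * E k" for k
  proof -
    have "(\<lambda>n. qbinomial (ee \<tau>) (2 * n) (nat (k + int n)) * E k) \<longlonglongrightarrow> 1 / ?Q * E k"
      by (intro tendsto_intros qbinomial_central_LIMSEQ)
    moreover have "eventually (\<lambda>n. qbinomial (ee \<tau>) (2 * n) (nat (k + int n)) * E k = f n k) sequentially"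
      using eventually_ge_at_top[of "nat \<bar>k\<bar>"] by eventually_elim (auto simp: f_def)
    ultimately show ?thesis by (rule Lim_transform_eventually)
  qed
  have "infsum (f n) UNIV = (\<Prod>k<n. 1 + ee z * ee \<tau> ^ k) * (\<Prod>k<n. 1 + ee (\<tau> - z) * ee \<tau> ^ k)" for n
  proof -
    have "infsum (f n) UNIV = infsum (f n) {- int n..int n}"
      by (rule infsum_cong_neutral) (auto simp: f_def)
    then show ?thesis
      unfolding finite_jacobi_triple_product by (simp add: f_def E_def)
  qed
  then have "(\<lambda>n. (\<Prod>k<n. 1 + ee z * ee \<tau> ^ k) * (\<Prod>k<n. 1 + ee (\<tau> - z) * ee \<tau> ^ k))
      \<longlonglongrightarrow> (\<Sum>\<^sub>\<infinity>k. 1 / ?Q * E k)"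
    using dominated_convergence_int[OF lim bound sum] by simp
  moreover have "(\<lambda>n. (\<Prod>k<n. 1 + ee z * ee \<tau> ^ k) * (\<Prod>k<n. 1 + ee (\<tau> - z) * ee \<tau> ^ k))
      \<longlonglongrightarrow> qpoch (- ee z) (ee \<tau>) * qpoch (- ee (\<tau> - z)) (ee \<tau>)"
    using qpoch_LIMSEQ[OF norm_ee_less_1[OF \<tau>], of "- ee z"]
      qpoch_LIMSEQ[OF norm_ee_less_1[OF \<tau>], of "- ee (\<tau> - z)"]
    by (intro tendsto_mult) simp_all
  ultimately have "(\<Sum>\<^sub>\<infinity>k. 1 / ?Q * E k) = qpoch (- ee z) (ee \<tau>) * qpoch (- ee (\<tau> - z)) (ee \<tau>)"
    by (rule LIMSEQ_unique)
  then have "1 / ?Q * infsum E UNIV = qpoch (- ee z) (ee \<tau>) * qpoch (- ee (\<tau> - z)) (ee \<tau>)"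
    unfolding infsum_cmult_right' .
  then show ?thesis
    using qpoch_ee_ee_nonzero[OF \<tau>] by (simp add: E_def[abs_def] field_simps)
qed

end

subsection \<open>The multiplier system of \<open>F\<close>\<close>

lemma dedekind_eta_eq: "dedekind_eta \<tau> = ee (\<tau> / 24) * qpoch (ee \<tau>) (ee \<tau>)"
  by (simp add: dedekind_eta_def ee_def qpoch_def)

lemma dedekind_eta_nonzero: "Im \<tau> > 0 \<Longrightarrow> dedekind_eta \<tau> \<noteq> 0"
  by (simp add: dedekind_eta_eq qpoch_ee_ee_nonzero)

text \<open>Writing n^2 = n(n - 1) + n brings the series into triple product form, and the half
  period in \<open>w = z + 1 / 2\<close> adjusts the signs. One \<open>Q\<close> from the triple
  product and two from the denominator of \<open>theta_prod\<close> form the product part of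
  eta^3.\<close>

lemma theta_char_eq_klein_form:
  fixes \<epsilon> \<delta> :: real
  assumes \<tau>: "Im \<tau> > 0"
  shows "theta_char \<epsilon> \<delta> 0 \<tau> = ee ((1 + \<delta> - \<epsilon> + \<epsilon> * \<delta>) / 8) *
    dedekind_eta \<tau> ^ 3 * klein_form ((1 + \<epsilon>) / 2) ((1 + \<delta>) / 2) \<tau>"
proof -
  define z where "z = (1 + \<epsilon>) / 2 * \<tau> + \<delta> / 2"
  define w where "w = (1 + \<epsilon>) / 2 * \<tau> + (1 + \<delta>) / 2"
  define Q where "Q = qpoch (ee \<tau>) (ee \<tau>)"
  have Q: "Q \<noteq> 0" unfolding Q_def by (rule qpoch_ee_ee_nonzero[OF \<tau>])
  have w: "w = z + 1 / 2" by (simp add: w_def z_def add_divide_distrib)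
  have ew: "ee w = - ee z" "ee (\<tau> - w) = - ee (\<tau> - z)"
    unfolding w by (simp_all add: ee_add ee_half ee_diff)
  have "theta_char \<epsilon> \<delta> 0 \<tau> = (\<Sum>\<^sub>\<infinity>n::int. ee (\<epsilon>\<^sup>2 * \<tau> / 8 + \<epsilon> * \<delta> / 4) *
      ee (of_int n * (of_int n - 1) / 2 * \<tau> + of_int n * z))"
    unfolding theta_char_def ee_add[symmetric]
    by (intro infsum_cong) (auto simp: ee_def z_def power2_eq_square field_simps)
  also have "\<dots> = ee (\<epsilon>\<^sup>2 * \<tau> / 8 + \<epsilon> * \<delta> / 4) *
      (qpoch (ee w) (ee \<tau>) * qpoch (ee (\<tau> - w)) (ee \<tau>) * Q)"
    unfolding infsum_cmult_right' jacobi_triple_product[OF \<tau>] ew Q_def ..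
  also have "\<dots> = ee (\<epsilon>\<^sup>2 * \<tau> / 8 + \<epsilon> * \<delta> / 4) * ee (w / 2) * Q ^ 3 * theta_prod w \<tau>"
    using Q unfolding theta_prod_def Q_def[symmetric]
    by (simp add: field_simps power2_eq_square power3_eq_cube ee_minus)
  \<comment> \<open>The constant phase is (1 - \<epsilon>)(1 + \<delta>)/8 + \<epsilon>\<delta>/4;
    the remaining power of \<open>ee \<tau>\<close> is the 1/8 belonging to eta^3.\<close>
  also have "ee (\<epsilon>\<^sup>2 * \<tau> / 8 + \<epsilon> * \<delta> / 4) * ee (w / 2) =
      ee ((1 + \<delta> - \<epsilon> + \<epsilon> * \<delta>) / 8) * (ee (\<tau> / 24) ^ 3 * ee ((1 + \<epsilon>) / 2 * w / 2))"
    unfolding ee_add[symmetric] ee_power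
    by (intro arg_cong[of _ _ ee]) (simp add: w_def field_simps power2_eq_square)
  finally show ?thesis
    by (simp add: dedekind_eta_eq klein_form_def w_def Q_def power_mult_distrib mult_ac)
qed

text \<open>With -3/5 in place of 7/5 both vectors are 3/5 times integer vectors, on which
  \<open>M\<close> acts.\<close>

definition klein_product :: "complex \<Rightarrow> complex" where
  "klein_product \<tau> = klein_form (3 / 5) (3 / 5) \<tau> * klein_form (3 / 5) (- 3 / 5) \<tau>"

text \<open>Existence of the constant suffices, as it cancels between \<open>F_fun\<close> at M tau
  and at tau.\<close>

lemma F_fun_eq_klein_product:
  obtains C where "\<And>\<tau>. Im \<tau> > 0 \<Longrightarrow> F_fun \<tau> = C / klein_product \<tau>"
proof -
  define c1 where "c1 = ee ((1 + 1/5 - 1/5 + 1/5 * (1/5)) / 8)"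
  have c1: "theta_char (1/5) (1/5) 0 \<tau> = c1 * dedekind_eta \<tau> ^ 3 * klein_form (3 / 5) (3 / 5) \<tau>"
    if "Im \<tau> > 0" for \<tau>
    using theta_char_eq_klein_form[OF that, of "1/5" "1/5"] by (simp add: c1_def)
  define c2 where "c2 = ee ((1 + 9/5 - 1/5 + 1/5 * (9/5)) / 8)"
  have c2: "theta_char (1/5) (9/5) 0 \<tau> = c2 * dedekind_eta \<tau> ^ 3 * klein_form (3 / 5) (7 / 5) \<tau>"
    if "Im \<tau> > 0" for \<tau>
    using theta_char_eq_klein_form[OF that, of "1/5" "9/5"] by (simp add: c2_def)
  define c3 where "c3 = ee (1 + 3 / 5)"
  have c3: "klein_form (3 / 5) (7 / 5) \<tau> = c3 * klein_form (3 / 5) (- 3 / 5) \<tau>"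
    if "Im \<tau> > 0" for \<tau>
    using klein_form_add_int[OF that, of "3 / 5" 0 "- 3 / 5" 2] by (simp add: c3_def)
  have "F_fun \<tau> = 1 / (c1 * c2 * c3) / klein_product \<tau>" if \<tau>: "Im \<tau> > 0" for \<tau>
  proof -
    define y where "y = dedekind_eta \<tau> ^ 3"
    have "y \<noteq> 0" "dedekind_eta \<tau> ^ 6 = y * y"
      using dedekind_eta_nonzero[OF \<tau>] by (simp_all add: y_def flip: power_add)
    then show ?thesis
      unfolding F_fun_def klein_product_def c1[OF \<tau>] c2[OF \<tau>] c3[OF \<tau>] y_def[symmetric] by simp
  qed
  then show thesis by (rule that)
qed

lemma klein_product_modular:
  fixes a b c d :: int
  assumes det: "a * d - b * c = 1" and \<tau>: "Im \<tau> > 0"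
  shows "klein_product ((of_int a * \<tau> + of_int b) / (of_int c * \<tau> + of_int d)) =
    klein_form (3 / 5 * of_int (a + c)) (3 / 5 * of_int (b + d)) \<tau> *
    klein_form (3 / 5 * of_int (a - c)) (3 / 5 * of_int (b - d)) \<tau> / (of_int c * \<tau> + of_int d) ^ 2"
proof -
  have "3 / 5 * of_int x + 3 / 5 * of_int y = (3 / 5 * of_int (x + y) :: complex)"
    "3 / 5 * of_int x + - 3 / 5 * of_int y = (3 / 5 * of_int (x - y) :: complex)" for x y
    by (simp_all add: algebra_simps)
  then show ?thesis
    unfolding klein_product_def klein_form_modular[OF det \<tau>] by (simp only: times_divide_times_eq power2_eq_square)
qed

lemma cong_int_obtain:
  fixes a r m :: int
  assumes "[a = r] (mod m)"
  shows "\<exists>k. a = r + m * k"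
  using cong_sym[OF assms] by (simp add: cong_iff_lin)

theorem mainTheorem4:
  fixes a b c d :: int and \<tau> :: complex
  assumes "(a, b, c, d) \<in> Gamma_theta5"
    and "Im \<tau> > 0"
  shows "F_fun ((of_int a * \<tau> + of_int b) / (of_int c * \<tau> + of_int d))
           = nu_F a b c d * (of_int c * \<tau> + of_int d) ^ 2 * F_fun \<tau>"
proof -
  note \<tau> = assms(2)
  have det: "a * d - b * c = 1" using assms(1) by (simp add: Gamma_theta5_def)
  define k1 where "k1 = klein_form (3 / 5) (3 / 5) \<tau>"
  define k2 where "k2 = klein_form (3 / 5) (- 3 / 5) \<tau>"
  define kk where "kk r s = klein_form (3 / 5 * of_int r) (3 / 5 * of_int s) \<tau>" for r s :: int
  define p where "p = kk (a + c) (b + d) * kk (a - c) (b - d)"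
  have kk: "kk 1 1 = k1" "kk 1 (- 1) = k2" "kk (- 1) (- 1) = - k1" "kk (- 1) 1 = - k2"
    using klein_form_minus[OF \<tau>, of "3/5" "3/5"] klein_form_minus[OF \<tau>, of "3/5" "- 3/5"]
    by (simp_all add: kk_def k1_def k2_def)
  have nu: "nu_F a b c d = ee (of_real (f_M a b c d) / 10)"
    by (simp add: nu_F_def ee_def mult_ac)
  \<comment> \<open>The phase of a translation by 5 (m, n), which moves the Klein vector by 3 (m,
    n); 9/10 is half of 3/5 times 3.\<close>
  define X :: "int \<Rightarrow> int \<Rightarrow> int \<Rightarrow> int \<Rightarrow> complex" where
    "X r s m n = of_int (3 * m + 3 * n + 9 * m * n) / 2 + 9 / 10 * of_int (r * n - s * m)" for r s m n
  have shift: "kk (r + 5 * m) (s + 5 * n) = ee (X r s m n) * kk r s" for r s m n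
  proof -
    have "3 / 5 * of_int (x + 5 * y) = (3 / 5 * of_int x + of_int (3 * y) :: complex)" for x y
      by simp
    then show ?thesis
      unfolding kk_def X_def
      by (simp only: klein_form_add_int[OF \<tau>])
        (intro arg_cong2[of _ _ _ _ "(*)"] arg_cong[of _ _ ee] refl, simp add: field_simps)
  qed
  \<comment> \<open>All phases are collected in one exponent \<open>y\<close>, so each case only has
    to find \<open>y\<close> modulo 1 and the signs of the \<open>kk\<close> values.\<close>
  have nu_p: "nu_F a b c d * p = ee y * (kk r1 s1 * kk r2 s2)"
    if "a + c = r1 + 5 * m1" "b + d = s1 + 5 * n1" "a - c = r2 + 5 * m2" "b - d = s2 + 5 * n2"
      and "of_real (f_M a b c d) / 10 + (X r1 s1 m1 n1 + X r2 s2 m2 n2) = y"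
    for r1 s1 m1 n1 r2 s2 m2 n2 y
    unfolding p_def nu that(1-4) shift that(5)[symmetric] by (simp add: ee_add)
  have p: "nu_F a b c d * p = k1 * k2"
  proof -
    consider "cong_I5 a b c d" | "cong_mI5 a b c d" | "cong_S5 a b c d" | "cong_mS5 a b c d"
      using assms(1) by (auto simp: Gamma_theta5_def)
    then show ?thesis
    proof cases
      case 1
      then have ABCD: "[a = 1] (mod 5)" "[b = 0] (mod 5)" "[c = 0] (mod 5)" "[d = 1] (mod 5)"
        by (simp_all add: cong_I5_def)
      obtain A B C D where M: "a = 1 + 5 * A" "b = 5 * B" "c = 5 * C" "d = 1 + 5 * D"
        using ABCD[THEN cong_int_obtain] by (metis add_0)
      have f: "f_M a b c d = 4 * b / 5 + 8 * a * b / 5 + 8 * c * d / 5"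
        using 1 by (auto simp: f_M_def cong_I5_def cong_mI5_def cong_S5_def cong_mS5_def cong_def)
      \<comment> \<open>An integer exponent, so the phase is trivial; both vectors return to
        themselves.\<close>
      have e: "of_real (f_M a b c d) / 10 + (X 1 1 (A + C) (B + D) + X 1 (- 1) (A - C) (B - D)) =
          of_int (3 * A + 6 * B - C + 13 * A * B + 13 * C * D)"
        unfolding f X_def by (simp add: M field_simps)
      show ?thesis
        by (subst nu_p[OF _ _ _ _ e]) (simp_all add: M kk ee_add ee_half del: of_int_add of_int_diff of_int_mult)
    next
      case 2
      then have ABCD: "[a = - 1] (mod 5)" "[b = 0] (mod 5)" "[c = 0] (mod 5)" "[d = - 1] (mod 5)"
        by (simp_all add: cong_mI5_def)
      obtain A B C D where M: "a = - 1 + 5 * A" "b = 5 * B" "c = 5 * C" "d = - 1 + 5 * D"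
        using ABCD[THEN cong_int_obtain] by (metis add_0)
      have f: "f_M a b c d = 6 * b / 5 + 8 * a * b / 5 + 8 * c * d / 5"
        using 2 by (auto simp: f_M_def cong_I5_def cong_mI5_def cong_S5_def cong_mS5_def cong_def)
      \<comment> \<open>Again a trivial phase; both vectors change sign, and the signs cancel in the
        product.\<close>
      have e: "of_real (f_M a b c d) / 10 + (X (- 1) (- 1) (A + C) (B + D) + X (- 1) 1 (A - C) (B - D)) =
          of_int (3 * A + B + C + 13 * A * B + 13 * C * D)"
        unfolding f X_def by (simp add: M field_simps)
      show ?thesis
        by (subst nu_p[OF _ _ _ _ e]) (simp_all add: M kk ee_add ee_half del: of_int_add of_int_diff of_int_mult)
    next
      case 3
      then have ABCD: "[a = 0] (mod 5)" "[b = - 1] (mod 5)" "[c = 1] (mod 5)" "[d = 0] (mod 5)"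
        by (simp_all add: cong_S5_def)
      obtain A B C D where M: "a = 5 * A" "b = - 1 + 5 * B" "c = 1 + 5 * C" "d = 5 * D"
        using ABCD[THEN cong_int_obtain] by (metis add_0)
      have f: "f_M a b c d = 5 + 4 * d / 5 + 8 * a * b / 5 + 8 * c * d / 5"
        using 3 by (auto simp: f_M_def cong_I5_def cong_mI5_def cong_S5_def cong_mS5_def cong_def)
      \<comment> \<open>The vectors are exchanged and only one changes sign; the 1/2, coming from
        the 5 in \<open>f_M\<close>, compensates.\<close>
      have e: "of_real (f_M a b c d) / 10 + (X 1 (- 1) (A + C) (B + D) + X (- 1) (- 1) (A - C) (B - D)) =
          of_int (4 * A + 3 * B + 3 * D + 13 * A * B + 13 * C * D) + 1 / 2"
        unfolding f X_def by (simp add: M field_simps)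
      show ?thesis
        by (subst nu_p[OF _ _ _ _ e]) (simp_all add: M kk ee_add ee_half del: of_int_add of_int_diff of_int_mult)
    next
      case 4
      then have ABCD: "[a = 0] (mod 5)" "[b = 1] (mod 5)" "[c = - 1] (mod 5)" "[d = 0] (mod 5)"
        by (simp_all add: cong_mS5_def)
      obtain A B C D where M: "a = 5 * A" "b = 1 + 5 * B" "c = - 1 + 5 * C" "d = 5 * D"
        using ABCD[THEN cong_int_obtain] by (metis add_0)
      have f: "f_M a b c d = 5 - 4 * d / 5 + 8 * a * b / 5 + 8 * c * d / 5"
        using 4 by (auto simp: f_M_def cong_I5_def cong_mI5_def cong_S5_def cong_mS5_def cong_def)
      have e: "of_real (f_M a b c d) / 10 + (X (- 1) 1 (A + C) (B + D) + X 1 1 (A - C) (B - D)) =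
          of_int (2 * A + 3 * B - 3 * D + 13 * A * B + 13 * C * D) + 1 / 2"
        unfolding f X_def by (simp add: M field_simps)
      show ?thesis
        by (subst nu_p[OF _ _ _ _ e]) (simp_all add: M kk ee_add ee_half del: of_int_add of_int_diff of_int_mult)
    qed
  qed
  obtain K where K: "\<And>\<tau>. Im \<tau> > 0 \<Longrightarrow> F_fun \<tau> = K / klein_product \<tau>"
    using F_fun_eq_klein_product by blast
  define w where "w = of_int c * \<tau> + of_int d"
  have "w \<noteq> 0"
    unfolding w_def using det by (intro int_multiple_add_nonzero \<tau>) auto
  have "Im ((of_int a * \<tau> + of_int b) / w) = of_int (a * d - b * c) * Im \<tau> / (norm w) ^ 2"
    by (simp add: Im_divide cmod_power2 w_def algebra_simps)
  then have "Im ((of_int a * \<tau> + of_int b) / w) > 0"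
    using det \<tau> \<open>w \<noteq> 0\<close> by simp
  then have "F_fun ((of_int a * \<tau> + of_int b) / w) = K * w ^ 2 / p"
    using klein_product_modular[OF det \<tau>, folded kk_def p_def w_def] by (simp add: K)
  \<comment> \<open>\<open>nu_F\<close> is a value of \<open>ee\<close>, hence nonzero, and may be
    inserted in numerator and denominator.\<close>
  also have "\<dots> = nu_F a b c d * w ^ 2 * (K / (nu_F a b c d * p))"
    by (simp add: nu)
  also have "K / (nu_F a b c d * p) = F_fun \<tau>"
    unfolding p by (simp add: K \<tau> klein_product_def k1_def k2_def)
  finally show ?thesis unfolding w_def .
qed

end
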